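(* Let $\mathcal T$ be an infinite, locally finite, rooted tree which is weakly uniformly transient, with critical value $\lambda_c=\lambda_c(\mathcal T)$. Then the effective conductance $\lambda\mapsto\mathcal C(\lambda,\mathcal T)$ is left continuous on $(\lambda_c,1]$.
   Context: For $\lambda>0$ and a rooted tree with root $o$, $RW_\lambda$ is the Markov chain on the vertices which, at a vertex $x\ne o$ with $k$ children, jumps to the parent of $x$ with probability $1/(1+k\lambda)$ and to each child with probability $\lambda/(1+k\lambda)$; from the root it jumps to a uniformly chosen child. The critical value $\lambda_c(\mathcal T)$ is such that $RW_\lambda$ on $\mathcal T$ is recurrent for $\lambda<\lambda_c(\mathcal T)$ and transient for $\lambda>\lambda_c(\mathcal T)$. Effective conductance: give each edge $(x,y)$, with $x$ the parent of $y$, the conductance $\lambda^{|x|}$, where $|x|$ is the distance from $x$ to the root. Then $\mathcal C(\lambda,\mathcal T)=\pi(o)\,\mathbb P(RW_\lambda\text{ started at }o\text{ never returns to }o)$, where $\pi(o)$ is the sum of conductances of edges at the root (the number of children of $o$). A V-cutset is a set $\pi$ of vertices such that every infinite self-avoiding path started at the root contains a vertex of $\pi$. For a vertex $\nu$, let $\mathcal T^\nu$ be the subtree formed by $\nu$ and its descendants, rooted at $\nu$, and let $(X^\nu_n)$ be the walk $RW_\lambda$ on $\mathcal T^\nu$ started at $\nu$ (if $\nu$ has no child, the walk stays at $\nu$). The tree $\mathcal T$ is weakly uniformly transient if there exists a sequence $(\pi_n)_{n\ge1}$ of finite, pairwise disjoint V-cutsets such that for every $\lambda>\lambda_c$ there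 is $\alpha_\lambda>0$ such that for every $\nu\in\bigcup_{k\ge1}\pi_k$, $\mathbb P(\forall n>0,\ X^\nu_n\ne\nu)\ge\alpha_\lambda$. *)

theory Defs
  imports "HOL-Probability.Probability"
begin

section \<open>Rooted trees\<close>

text \<open>A rooted tree is encoded with its edges oriented away from the root, so that
  \<open>(x, y) \<in> arcs T\<close> means that \<open>x\<close> is the parent of \<open>y\<close>.\<close>

record 'a rtree =
  verts :: "'a set"
  arcs :: "('a \<times> 'a) set"
  root :: 'a

definition rooted_tree :: "'a rtree \<Rightarrow> bool" where
  "rooted_tree T \<longleftrightarrow>
     root T \<in> verts T \<and> arcs T \<subseteq> verts T \<times> verts T \<and>
     (\<forall>x. (x, root T) \<notin> arcs T) \<and>
     (\<forall>y \<in> verts T - {root T}. \<exists>!x. (x, y) \<in> arcs T) \<and>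
     (\<forall>y \<in> verts T. (root T, y) \<in> (arcs T)\<^sup>*)"

definition children :: "'a rtree \<Rightarrow> 'a \<Rightarrow> 'a set" where
  "children T x = {y. (x, y) \<in> arcs T}"

definition locally_finite :: "'a rtree \<Rightarrow> bool" where
  "locally_finite T \<longleftrightarrow> (\<forall>x \<in> verts T. finite (children T x))"

text \<open>The unique path from the root to \<open>x\<close> is directed, so its length is the graph distance.\<close>

definition depth :: "'a rtree \<Rightarrow> 'a \<Rightarrow> nat" where
  "depth T x = (LEAST n. (root T, x) \<in> arcs T ^^ n)"

definition descendants :: "'a rtree \<Rightarrow> 'a \<Rightarrow> 'a set" where
  "descendants T v = (arcs T)\<^sup>* `` {v}"

definition subtree :: "'a rtree \<Rightarrow> 'a \<Rightarrow> 'a rtree" where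
  "subtree T v = \<lparr> verts = descendants T v,
                   arcs = arcs T \<inter> (descendants T v \<times> descendants T v),
                   root = v \<rparr>"

definition infinite_sa_path :: "'a rtree \<Rightarrow> (nat \<Rightarrow> 'a) \<Rightarrow> bool" where
  "infinite_sa_path T p \<longleftrightarrow>
     (\<forall>n. (p n, p (Suc n)) \<in> arcs T \<or> (p (Suc n), p n) \<in> arcs T) \<and> inj p"

definition V_cutset :: "'a rtree \<Rightarrow> 'a set \<Rightarrow> bool" where
  "V_cutset T S \<longleftrightarrow>
     S \<subseteq> verts T \<and> (\<forall>p. infinite_sa_path T p \<and> p 0 = root T \<longrightarrow> (\<exists>n. p n \<in> S))"

section \<open>Time-homogeneous Markov chains\<close>

definition chain_kernel :: "('a \<Rightarrow> 'a pmf) \<Rightarrow> 'a \<Rightarrow> nat \<Rightarrow> (nat \<Rightarrow> 'a) \<Rightarrow> 'a measure" where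
  "chain_kernel K x n \<omega> =
     (case n of 0 \<Rightarrow> measure_pmf (return_pmf x) | Suc m \<Rightarrow> measure_pmf (K (\<omega> m)))"

definition chain_law :: "('a \<Rightarrow> 'a pmf) \<Rightarrow> 'a \<Rightarrow> (nat \<Rightarrow> 'a) measure" where
  "chain_law K x =
     projective_family.lim UNIV
       (Ionescu_Tulcea.CI (chain_kernel K x) (\<lambda>_. count_space UNIV)) (\<lambda>_. count_space UNIV)"

lemma Ionescu_Tulcea_chain: "Ionescu_Tulcea (chain_kernel K x) (\<lambda>_. count_space UNIV)"
proof (rule Ionescu_Tulcea.intro)
  fix i :: nat
  show "chain_kernel K x i
      \<in> measurable (PiM {0..<i} (\<lambda>_. count_space UNIV)) (subprob_algebra (count_space UNIV))"
  proof (cases i)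
    case 0
    then show ?thesis
      unfolding chain_kernel_def[abs_def] by simp
  next
    case (Suc m)
    have "(\<lambda>\<omega>. \<omega> m) \<in> measurable (PiM {0..<i} (\<lambda>_. count_space UNIV :: 'a measure))
        (count_space UNIV)"
      using Suc by (intro measurable_component_singleton) auto
    from measurable_compose[OF this, of "\<lambda>y. measure_pmf (K y)"
        "subprob_algebra (count_space UNIV)"]
    show ?thesis
      using Suc by (simp add: chain_kernel_def[abs_def] measure_pmf_in_subprob_algebra)
  qed
next
  fix i :: nat and \<omega>
  show "prob_space (chain_kernel K x i \<omega>)"
    by (auto simp: chain_kernel_def prob_space_measure_pmf split: nat.split)
qed

lemma sets_chain_law: "sets (chain_law K x) = sets (PiM UNIV (\<lambda>_. count_space UNIV))"
proof -
  interpret Ionescu_Tulcea "chain_kernel K x" "\<lambda>_. count_space UNIV"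
    by (rule Ionescu_Tulcea_chain)
  show ?thesis by (simp add: chain_law_def)
qed

lemma space_chain_law: "space (chain_law K x) = UNIV"
  using sets_eq_imp_space_eq[OF sets_chain_law] by (simp add: space_PiM)

lemma prob_space_chain_law: "prob_space (chain_law K x)"
proof -
  interpret Ionescu_Tulcea "chain_kernel K x" "\<lambda>_. count_space UNIV"
    by (rule Ionescu_Tulcea_chain)
  interpret P: prob_space "CI {}" by (rule PF.prob_space_P) auto
  have "emeasure PF.lim (PF.emb UNIV {} {\<lambda>_. undefined}) = emeasure (CI {}) {\<lambda>_. undefined}"
    by (rule lim) (auto simp: PiM_empty)
  moreover have "PF.emb UNIV {} {\<lambda>_. undefined} = UNIV"
    by (auto simp: prod_emb_def space_PiM restrict_def)
  moreover have "emeasure (CI {}) {\<lambda>_. undefined} = 1"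
    using P.emeasure_space_1 PF.space_P[of "{}"] by (simp add: space_PiM)
  ultimately show ?thesis
    by (intro prob_spaceI) (simp add: chain_law_def space_PiM)
qed

lemma emeasure_chain_law_cylinder:
  "emeasure (chain_law K x) {\<omega>. \<forall>i\<le>n. \<omega> i = s i} =
     ennreal (indicator {x} (s 0) * (\<Prod>i<n. pmf (K (s i)) (s (Suc i))))"
proof -
  interpret Ionescu_Tulcea "chain_kernel K x" "\<lambda>_. count_space UNIV"
    by (rule Ionescu_Tulcea_chain)
  let ?X = "\<lambda>n. {restrict s {0..<n}}"
  let ?u = "\<lambda>_ :: nat. undefined :: 'a"
  have X_eq: "?X n = PiE {0..<n} (\<lambda>i. {s i})" for n :: nat
    by (auto simp: PiE_iff extensional_def restrict_def fun_eq_iff)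
  have X[measurable]: "?X n \<in> sets (PiM {0..<n} (\<lambda>_. count_space UNIV))" for n :: nat
    unfolding X_eq by (intro sets_PiM_I_finite) auto
  have u: "?u \<in> space (PiM {0..<0} (\<lambda>_. count_space UNIV))"
    by (simp add: space_PiM)
  have step: "emeasure (C 0 (Suc n) ?u) (?X (Suc n)) =
      emeasure (C 0 n ?u) (?X n) * emeasure (chain_kernel K x n s) {s n}" for n
  proof -
    have eP: "emeasure (eP n \<omega>) (?X (Suc n)) =
        indicator (?X n) \<omega> * emeasure (chain_kernel K x n s) {s n}"
      if \<omega>: "\<omega> \<in> space (PiM {0..<n} (\<lambda>_. count_space UNIV))" for \<omega>
    proof (cases "\<omega> = restrict s {0..<n}")
      case True
      have "fun_upd \<omega> n y = restrict s {0..<Suc n} \<longleftrightarrow> y = s n" for y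
      proof
        assume "fun_upd \<omega> n y = restrict s {0..<Suc n}"
        from fun_cong[OF this, of n] show "y = s n" by simp
      qed (auto simp: True fun_eq_iff restrict_def)
      then have "(\<lambda>y. fun_upd \<omega> n y) -` ?X (Suc n) = {s n}" by auto
      moreover have "chain_kernel K x n \<omega> = chain_kernel K x n s"
        by (simp add: True chain_kernel_def split: nat.split)
      ultimately show ?thesis
        using emeasure_eP[OF \<omega> X] True by simp
    next
      case False
      have "\<omega> \<in> extensional {0..<n}" using \<omega> by (auto simp: space_PiM PiE_iff)
      with False obtain i where "i < n" "\<omega> i \<noteq> s i"
        by (auto simp: fun_eq_iff restrict_def extensional_def split: if_splits)
      have "fun_upd \<omega> n y \<noteq> restrict s {0..<Suc n}" for y
      proof
        assume "fun_upd \<omega> n y = restrict s {0..<Suc n}"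
        from fun_cong[OF this, of i] show False using \<open>i < n\<close> \<open>\<omega> i \<noteq> s i\<close> by simp
      qed
      then have "(\<lambda>y. fun_upd \<omega> n y) -` ?X (Suc n) = {}" by auto
      then show ?thesis
        using emeasure_eP[OF \<omega> X] False by simp
    qed
    have sp: "space (C 0 n ?u) = space (PiM {0..<n} (\<lambda>_. count_space UNIV))"
      using space_C[OF u, of n] by simp
    have se: "sets (C 0 n ?u) = sets (PiM {0..<n} (\<lambda>_. count_space UNIV))"
      using sets_C[OF u, of n] by simp
    have "emeasure (C 0 (Suc n) ?u) (?X (Suc n)) =
        (\<integral>\<^sup>+\<omega>. emeasure (eP n \<omega>) (?X (Suc n)) \<partial>C 0 n ?u)"
      using measurable_eP[of n] X[of "Suc n"] space_PiM_not_empty se sp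
      by (simp, intro emeasure_bind[where N = "PiM {0..<Suc n} (\<lambda>_. count_space UNIV)"])
         (auto simp: space_PiM PiE_eq_empty_iff cong: measurable_cong_sets)
    also have "\<dots> = (\<integral>\<^sup>+\<omega>. emeasure (chain_kernel K x n s) {s n} * indicator (?X n) \<omega> \<partial>C 0 n ?u)"
      by (intro nn_integral_cong) (simp add: sp eP mult.commute)
    also have "\<dots> = emeasure (chain_kernel K x n s) {s n} * emeasure (C 0 n ?u) (?X n)"
      using X[of n] se by (intro nn_integral_cmult_indicator) simp
    finally show ?thesis by (simp add: mult.commute)
  qed
  have k0: "emeasure (chain_kernel K x 0 s) {s 0} = ennreal (indicator {x} (s 0))"
    by (simp add: chain_kernel_def indicator_def)
  have kS: "emeasure (chain_kernel K x (Suc n) s) {s (Suc n)} = ennreal (pmf (K (s n)) (s (Suc n)))"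
    for n by (simp add: chain_kernel_def emeasure_pmf_single)
  have C: "emeasure (C 0 (Suc n) ?u) (?X (Suc n)) =
      ennreal (indicator {x} (s 0) * (\<Prod>i<n. pmf (K (s i)) (s (Suc i))))" for n
  proof (induction n)
    case 0
    have "emeasure (C 0 0 ?u) (?X 0) = 1"
      by (simp add: PiM_empty restrict_def)
    then show ?case
      by (simp only: step k0) simp
  next
    case (Suc n)
    then show ?case
      by (simp only: step[of "Suc n"] kS)
         (simp add: ennreal_mult[symmetric] prod_nonneg mult.assoc del: C.simps)
  qed
  have "{\<omega>. \<forall>i\<le>n. \<omega> i = s i} = PF.emb UNIV {0..<Suc n} (?X (Suc n))"
  proof (intro set_eqI iffI)
    fix \<omega> assume "\<omega> \<in> PF.emb UNIV {0..<Suc n} (?X (Suc n))"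
    then have *: "restrict \<omega> {0..<Suc n} = restrict s {0..<Suc n}" by (auto simp: prod_emb_def)
    have "\<omega> i = s i" if "i \<le> n" for i
      using fun_cong[OF *, of i] that by simp
    then show "\<omega> \<in> {\<omega>. \<forall>i\<le>n. \<omega> i = s i}" by simp
  qed (auto simp: prod_emb_def space_PiM restrict_def fun_eq_iff)
  then have "emeasure (chain_law K x) {\<omega>. \<forall>i\<le>n. \<omega> i = s i} =
      emeasure (CI {0..<Suc n}) (?X (Suc n))"
    by (simp only: chain_law_def lim[OF finite_atLeastLessThan X])
  also have "\<dots> = emeasure (C 0 (Suc n) ?u) (PF.emb {0..<Suc n} {0..<Suc n} (?X (Suc n)))"
    by (rule emeasure_CI[OF subset_refl X])
  also have "PF.emb {0..<Suc n} {0..<Suc n} (?X (Suc n)) = ?X (Suc n)"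
    by (intro prod_emb_id) (auto simp: PiE_iff)
  finally show ?thesis by (simp only: C)
qed

section \<open>The biased random walk\<close>

definition rw_step :: "real \<Rightarrow> 'a rtree \<Rightarrow> 'a \<Rightarrow> 'a pmf" where
  "rw_step l T x =
     (if x = root T
      then (if children T x = {} then return_pmf x else pmf_of_set (children T x))
      else embed_pmf (\<lambda>y. if (y, x) \<in> arcs T then 1 / (1 + real (card (children T x)) * l)
                          else if (x, y) \<in> arcs T then l / (1 + real (card (children T x)) * l)
                          else 0))"

lemma pmf_rw_step:
  assumes T: "rooted_tree T" "locally_finite T" and x: "x \<in> verts T" "x \<noteq> root T" and l: "0 < l"
  shows "pmf (rw_step l T x) y =
     (if (y, x) \<in> arcs T then 1 / (1 + real (card (children T x)) * l)
      else if (x, y) \<in> arcs T then l / (1 + real (card (children T x)) * l) else 0)"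
proof -
  let ?D = "1 + real (card (children T x)) * l"
  let ?f = "\<lambda>y. if (y, x) \<in> arcs T then 1 / ?D else if (x, y) \<in> arcs T then l / ?D else 0"
  have D: "?D > 0" using l by (simp add: add_pos_nonneg)
  obtain p where p: "(p, x) \<in> arcs T" and p_unique: "\<And>q. (q, x) \<in> arcs T \<Longrightarrow> q = p"
    using T(1) x unfolding rooted_tree_def by blast
  have fin: "finite (children T x)" using T(2) x by (simp add: locally_finite_def)
  have "(x, p) \<notin> arcs T"
  proof
    assume xp: "(x, p) \<in> arcs T"
    then have "root T \<notin> {x, p}" using T(1) p by (auto simp: rooted_tree_def)
    moreover have "p \<in> verts T" using T(1) p by (auto simp: rooted_tree_def)
    ultimately have "p \<in> verts T - {root T}" by blast
    then have "\<exists>!q. (q, p) \<in> arcs T" using T(1) unfolding rooted_tree_def by blast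
    then have pre: "\<And>q. (q, p) \<in> arcs T \<Longrightarrow> q = x" using xp by blast
    have "(root T, x) \<in> (arcs T)\<^sup>*" using T(1) x by (simp add: rooted_tree_def)
    then have "z \<in> {x, p} \<Longrightarrow> (root T, z) \<in> (arcs T)\<^sup>* \<Longrightarrow> False" for z
    proof -
      assume "z \<in> {x, p}" "(root T, z) \<in> (arcs T)\<^sup>*"
      from this(2,1) show False
        by (induction rule: rtrancl_induct) (use \<open>root T \<notin> {x, p}\<close> pre p_unique in auto)
    qed
    then show False using \<open>(root T, x) \<in> (arcs T)\<^sup>*\<close> by blast
  qed
  then have pC: "p \<notin> children T x" by (simp add: children_def)
  have "(\<integral>\<^sup>+ y. ennreal (?f y) \<partial>count_space UNIV) =
      (\<Sum>y\<in>insert p (children T x). ennreal (?f y))"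
    using fin by (intro nn_integral_count_space') (auto simp: children_def dest: p_unique)
  also have "\<dots> = ennreal (\<Sum>y\<in>insert p (children T x). ?f y)"
    using D l by (intro sum_ennreal) auto
  also have "(\<Sum>y\<in>insert p (children T x). ?f y) = ?f p + (\<Sum>y\<in>children T x. ?f y)"
    using fin pC by (rule sum.insert)
  also have "(\<Sum>y\<in>children T x. ?f y) = (\<Sum>y\<in>children T x. l / ?D)"
  proof (rule sum.cong)
    fix y assume y: "y \<in> children T x"
    then have "(y, x) \<notin> arcs T" using p_unique[of y] pC by blast
    then show "?f y = l / ?D" using y by (simp add: children_def)
  qed simp
  also have "?f p = 1 / ?D" using p by simp
  also have "1 / ?D + (\<Sum>y\<in>children T x. l / ?D) = 1"
    using D by (simp add: field_simps)
  finally have "(\<integral>\<^sup>+ y. ennreal (?f y) \<partial>count_space UNIV) = 1" by simp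
  then have "pmf (embed_pmf ?f) y = ?f y"
    using D l by (intro pmf_embed_pmf) auto
  then show ?thesis using x by (simp add: rw_step_def)
qed

definition rw_law :: "real \<Rightarrow> 'a rtree \<Rightarrow> 'a \<Rightarrow> (nat \<Rightarrow> 'a) measure" where
  "rw_law l T x = chain_law (rw_step l T) x"

definition escape_prob :: "real \<Rightarrow> 'a rtree \<Rightarrow> 'a \<Rightarrow> real" where
  "escape_prob l T x = measure (rw_law l T x) {\<omega>. \<forall>n>0. \<omega> n \<noteq> x}"

definition return_prob :: "real \<Rightarrow> 'a rtree \<Rightarrow> 'a \<Rightarrow> real" where
  "return_prob l T x = measure (rw_law l T x) {\<omega>. \<exists>n>0. \<omega> n = x}"

definition rw_recurrent :: "real \<Rightarrow> 'a rtree \<Rightarrow> bool" where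
  "rw_recurrent l T \<longleftrightarrow> (\<forall>x \<in> verts T. return_prob l T x = 1)"

definition rw_transient :: "real \<Rightarrow> 'a rtree \<Rightarrow> bool" where
  "rw_transient l T \<longleftrightarrow> (\<forall>x \<in> verts T. return_prob l T x < 1)"

text \<open>The walk is only defined for positive bias, hence the constraints \<open>0 \<le> c\<close> and \<open>0 < l\<close>.\<close>

definition critical_value :: "'a rtree \<Rightarrow> real \<Rightarrow> bool" where
  "critical_value T c \<longleftrightarrow>
     0 \<le> c \<and> (\<forall>l. 0 < l \<and> l < c \<longrightarrow> rw_recurrent l T) \<and> (\<forall>l. c < l \<longrightarrow> rw_transient l T)"

lemma critical_value_unique:
  assumes "rooted_tree T" "critical_value T c" "critical_value T d"
  shows "c = d"
proof -
  have False if "critical_value T a" "critical_value T b" "a < b" for a b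
  proof -
    obtain l where l: "a < l" "l < b" using dense[OF \<open>a < b\<close>] by blast
    with that have "rw_recurrent l T" "rw_transient l T"
      by (auto simp: critical_value_def)
    moreover have "root T \<in> verts T" using assms(1) by (simp add: rooted_tree_def)
    ultimately show False by (auto simp: rw_recurrent_def rw_transient_def)
  qed
  then show ?thesis using assms(2,3) by (meson linorder_neqE_linordered_idom)
qed

definition conductance :: "real \<Rightarrow> 'a rtree \<Rightarrow> 'a \<times> 'a \<Rightarrow> real" where
  "conductance l T e = l ^ depth T (fst e)"

definition effective_conductance :: "real \<Rightarrow> 'a rtree \<Rightarrow> real" where
  "effective_conductance l T =
     (\<Sum>y \<in> children T (root T). conductance l T (root T, y)) * escape_prob l T (root T)"

definition weakly_uniformly_transient :: "'a rtree \<Rightarrow> real \<Rightarrow> bool" where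
  "weakly_uniformly_transient T c \<longleftrightarrow>
     (\<exists>\<pi> :: nat \<Rightarrow> 'a set.
        (\<forall>n\<ge>1. finite (\<pi> n) \<and> V_cutset T (\<pi> n)) \<and> disjoint_family_on \<pi> {1..} \<and>
        (\<forall>l>c. \<exists>\<alpha>>0. \<forall>v \<in> (\<Union>k\<in>{1..}. \<pi> k). escape_prob l (subtree T v) v \<ge> \<alpha>))"

end

(*
  Let C(x) be the effective conductance from x to infinity in the subtree below x, normalised so
  that the edges at x have conductance 1.  The series and parallel laws give
    C(x) = sum over the children y of x of l C(y) / (1 + l C(y)),
  and C is the decreasing limit of the finite conductances, hence increasing in l.  The left limit
  a of C at l solves the same recursion, so the point is that a and C agree at the root.
  Weight each edge into y by k(y) = l / ((1 + l a(y)) (1 + l C(y))).  Subtracting the recursions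
  shows that C - a is a k-flow, and C is a k-superflow that loses l a(y) C(y) at each y.  Every
  cutset absorbs the whole flow C - a, and on the cutsets of uniform transience a >= alpha, so
  there C - a <= a C / alpha.  As the total loss is finite and the cutsets are disjoint,
  N (C - a)(root) is bounded independently of the number N of cutsets.
*)

theory Submission
  imports Defs
begin

section \<open>Finite-time avoidance probabilities of a Markov chain, and their limit\<close>

section \<open>Avoiding a state\<close>

text \<open>This is the probability that the chain from \<open>y\<close> is not at \<open>r\<close>
  at times 1 to \<open>n\<close>. Time 0 is not tested, so \<open>y = r\<close> is allowed. The
  reading presumes finite supports, since \<open>sum\<close> over an infinite set is 0.\<close>

primrec avoid :: "('a \<Rightarrow> 'a pmf) \<Rightarrow> 'a \<Rightarrow> nat \<Rightarrow> 'a \<Rightarrow> real" where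
  "avoid K r 0 y = 1"
| "avoid K r (Suc n) y = (\<Sum>z\<in>set_pmf (K y) - {r}. pmf (K y) z * avoid K r n z)"

lemma sets_chain_law_component:
  "{\<omega>. P (\<omega> i)} \<in> sets (chain_law K x)"
proof -
  have "(\<lambda>\<omega>. \<omega> i) \<in> measurable (PiM UNIV (\<lambda>_. count_space UNIV)) (count_space UNIV)"
    by (rule measurable_component_singleton) simp
  then have "(\<lambda>\<omega>. \<omega> i) \<in> measurable (chain_law K x) (count_space UNIV)"
    by (simp only: measurable_cong_sets[OF sets_chain_law refl])
  from measurable_sets[OF this, of "Collect P"] show ?thesis
    by (simp add: space_chain_law vimage_def)
qed

lemma pred_chain_law [measurable]: "Measurable.pred (chain_law K x) (\<lambda>\<omega>. P (\<omega> i))"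
  by (simp add: pred_def space_chain_law sets_chain_law_component)

lemma sets_chain_law_pred:
  "Measurable.pred (chain_law K x) P \<Longrightarrow> {\<omega>. P \<omega>} \<in> sets (chain_law K x)"
  by (simp add: pred_def space_chain_law)

lemma measure_chain_law_cylinder:
  "measure (chain_law K x) {\<omega>. \<forall>i\<le>n. \<omega> i = s i} =
     indicator {x} (s 0) * (\<Prod>i<n. pmf (K (s i)) (s (Suc i)))"
  unfolding measure_def emeasure_chain_law_cylinder
  by (simp add: prod_nonneg)

lemma measure_chain_law_cylinder_Suc:
  "measure (chain_law K x) {\<omega>. \<forall>i\<le>Suc m. \<omega> i = (s(Suc m := z)) i} =
     measure (chain_law K x) {\<omega>. \<forall>i\<le>m. \<omega> i = s i} * pmf (K (s m)) z"
  unfolding measure_chain_law_cylinder by simp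

text \<open>The Markov property, obtained from cylinder probabilities alone. The prefix
  \<open>s\<close> is arbitrary because each induction step appends the next state to it.\<close>

lemma measure_chain_law_avoid:
  assumes fin: "\<And>y. y \<in> V \<Longrightarrow> finite (set_pmf (K y))"
    and closed: "\<And>y. y \<in> V \<Longrightarrow> set_pmf (K y) \<subseteq> V"
    and "s m \<in> V"
  shows "measure (chain_law K x)
      {\<omega>. (\<forall>i\<le>m. \<omega> i = s i) \<and> (\<forall>i. m < i \<and> i \<le> m + n \<longrightarrow> \<omega> i \<noteq> r)} =
    measure (chain_law K x) {\<omega>. \<forall>i\<le>m. \<omega> i = s i} * avoid K r n (s m)"
  using \<open>s m \<in> V\<close>
proof (induction n arbitrary: m s)
  case 0
  have "(\<forall>i. m < i \<and> i \<le> m + 0 \<longrightarrow> \<omega> i \<noteq> r) = True" for \<omega> :: "nat \<Rightarrow> 'a" by auto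
  then show ?case unfolding avoid.simps mult_1_right by presburger
next
  case (Suc n)
  interpret P: prob_space "chain_law K x" by (rule prob_space_chain_law)
  let ?M = "chain_law K x" and ?S = "set_pmf (K (s m))"
  let ?cyl = "{\<omega>. \<forall>i\<le>m. \<omega> i = s i}"
  let ?A = "{\<omega>. (\<forall>i\<le>m. \<omega> i = s i) \<and> (\<forall>i. m < i \<and> i \<le> m + Suc n \<longrightarrow> \<omega> i \<noteq> r)}"
  let ?N = "{\<omega>. (\<forall>i\<le>m. \<omega> i = s i) \<and> \<omega> (Suc m) \<notin> ?S}"
  define C where "C z = {\<omega>. (\<forall>i\<le>m. \<omega> i = s i) \<and> \<omega> (Suc m) = z}" for z
  define B where "B z = {\<omega>. (\<forall>i\<le>m. \<omega> i = s i) \<and> \<omega> (Suc m) = z \<and>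
      (\<forall>i. Suc m < i \<and> i \<le> Suc m + n \<longrightarrow> \<omega> i \<noteq> r)}" for z
  have finS: "finite ?S" using fin Suc.prems by blast
  have sets_C: "C z \<in> sets ?M" for z
    unfolding C_def by (rule sets_chain_law_pred) measurable
  have [measurable]: "?cyl \<in> sets ?M" "?A \<in> sets ?M" "?N \<in> sets ?M" "B z \<in> sets ?M" for z
    unfolding B_def by (rule sets_chain_law_pred, measurable)+
  have upd: "(\<forall>i\<le>Suc m. \<omega> i = (s(Suc m := z)) i) \<longleftrightarrow> (\<forall>i\<le>m. \<omega> i = s i) \<and> \<omega> (Suc m) = z" for \<omega> z
    by (auto simp: le_Suc_eq)
  then have "C z = {\<omega>. \<forall>i\<le>Suc m. \<omega> i = (s(Suc m := z)) i}" for z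
    by (simp only: C_def)
  then have C: "measure ?M (C z) = measure ?M ?cyl * pmf (K (s m)) z"
      "measure ?M {\<omega>. \<forall>i\<le>Suc m. \<omega> i = (s(Suc m := z)) i} = measure ?M (C z)" for z
    by (simp_all only: measure_chain_law_cylinder_Suc)
  \<comment> \<open>The one-step extensions of the cylinder over the support already carry its whole
    mass, because the step probabilities sum to 1. Hence \<open>?N\<close> is null and the event
    splits over finitely many next states.\<close>
  have "?cyl = (\<Union>z\<in>?S. C z) \<union> ?N" unfolding C_def by blast
  then have "measure ?M ?cyl = measure ?M ((\<Union>z\<in>?S. C z) \<union> ?N)" by metis
  also have "\<dots> = measure ?M (\<Union>z\<in>?S. C z) + measure ?M ?N"
    using finS by (intro P.finite_measure_Union sets.finite_UN) (auto simp: C_def sets_C[unfolded C_def])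
  also have "measure ?M (\<Union>z\<in>?S. C z) = (\<Sum>z\<in>?S. measure ?M (C z))"
    using finS by (intro P.finite_measure_finite_Union) (auto simp: disjoint_family_on_def C_def sets_C[unfolded C_def])
  also have "\<dots> = measure ?M ?cyl * (\<Sum>z\<in>?S. pmf (K (s m)) z)"
    by (simp add: C sum_distrib_left)
  also have "(\<Sum>z\<in>?S. pmf (K (s m)) z) = 1"
    using finS by (intro sum_pmf_eq_1) auto
  finally have N0: "measure ?M ?N = 0" by simp
  have B_Suc: "\<omega> (Suc m) = z" if "\<omega> \<in> B z" for \<omega> z
    using that by (simp add: B_def)
  have B_iff: "\<omega> \<in> ?A \<and> \<omega> (Suc m) = z \<longleftrightarrow> \<omega> \<in> B z" if "z \<noteq> r" for \<omega> z
  proof -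
    have "(\<forall>i. m < i \<and> i \<le> m + Suc n \<longrightarrow> \<omega> i \<noteq> r) \<longleftrightarrow>
        \<omega> (Suc m) \<noteq> r \<and> (\<forall>i. Suc m < i \<and> i \<le> Suc m + n \<longrightarrow> \<omega> i \<noteq> r)"
      by (metis Suc_leI add_Suc_right add_Suc le_add1 le_neq_implies_less lessI less_trans)
    then show ?thesis using that by (auto simp: B_def)
  qed
  have A_eq: "?A - ?N = (\<Union>z\<in>?S - {r}. B z)"
  proof (rule set_eqI)
    fix \<omega>
    have "\<omega> \<in> ?A - ?N \<longleftrightarrow> \<omega> \<in> ?A \<and> \<omega> (Suc m) \<in> ?S" by blast
    also have "\<dots> \<longleftrightarrow> (\<exists>z\<in>?S - {r}. \<omega> \<in> ?A \<and> \<omega> (Suc m) = z)" by auto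
    also have "\<dots> \<longleftrightarrow> (\<exists>z\<in>?S - {r}. \<omega> \<in> B z)"
      by (rule bex_cong[OF refl], rule B_iff) simp
    finally show "\<omega> \<in> ?A - ?N \<longleftrightarrow> \<omega> \<in> (\<Union>z\<in>?S - {r}. B z)" by simp
  qed
  have "?N \<in> null_sets ?M"
    by (rule null_setsI) (simp only: P.emeasure_eq_measure N0 ennreal_0, measurable)
  moreover have "?A \<in> sets ?M" by measurable
  ultimately have "measure ?M ?A = measure ?M (?A - ?N)"
    by (simp only: measure_Diff_null_set)
  also have "\<dots> = measure ?M (\<Union>z\<in>?S - {r}. B z)" by (simp only: A_eq)
  also have "\<dots> = (\<Sum>z\<in>?S - {r}. measure ?M (B z))"
    using finS
    by (intro P.finite_measure_finite_Union) (auto simp: disjoint_family_on_def dest: B_Suc)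
  also have "\<dots> = (\<Sum>z\<in>?S - {r}. measure ?M (C z) * avoid K r n z)"
  proof (rule sum.cong)
    fix z assume "z \<in> ?S - {r}"
    then have "(s(Suc m := z)) (Suc m) \<in> V" using closed Suc.prems by auto
    note IH = Suc.IH[where m = "Suc m" and s = "s(Suc m := z)", OF this]
    have "B z = {\<omega>. (\<forall>i\<le>Suc m. \<omega> i = (s(Suc m := z)) i) \<and>
        (\<forall>i. Suc m < i \<and> i \<le> Suc m + n \<longrightarrow> \<omega> i \<noteq> r)}"
      by (simp only: B_def upd conj_assoc)
    then show "measure ?M (B z) = measure ?M (C z) * avoid K r n z"
      using IH by (simp only: C(2) fun_upd_same)
  qed simp
  also have "\<dots> = measure ?M ?cyl * avoid K r (Suc n) (s m)"
    by (simp add: C(1) sum_distrib_left mult.assoc)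
  finally show ?case .
qed

text \<open>Continuity from above along the decreasing events of avoiding \<open>x\<close> up to
  time \<open>n\<close>.\<close>

lemma avoid_tendsto_escape:
  assumes fin: "\<And>y. y \<in> V \<Longrightarrow> finite (set_pmf (K y))"
    and closed: "\<And>y. y \<in> V \<Longrightarrow> set_pmf (K y) \<subseteq> V"
    and x: "x \<in> V"
  shows "(\<lambda>n. avoid K x n x) \<longlonglongrightarrow> measure (chain_law K x) {\<omega>. \<forall>n>0. \<omega> n \<noteq> x}"
proof -
  interpret P: prob_space "chain_law K x" by (rule prob_space_chain_law)
  let ?M = "chain_law K x"
  let ?E = "\<lambda>n. {\<omega>. \<omega> 0 = x \<and> (\<forall>i. 0 < i \<and> i \<le> n \<longrightarrow> \<omega> i \<noteq> x)}"
  have [measurable]: "?E n \<in> sets ?M" for n by (rule sets_chain_law_pred, measurable)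
  have start: "measure ?M {\<omega>. \<omega> 0 = x} = 1"
    using measure_chain_law_cylinder[of K x 0 "\<lambda>_. x"] by simp
  have "measure ?M (?E n) = avoid K x n x" for n
    using measure_chain_law_avoid[where s = "\<lambda>_. x" and m = 0 and n = n and r = x and x = x,
      OF fin closed x] start by simp
  moreover have "(\<lambda>n. measure ?M (?E n)) \<longlonglongrightarrow> measure ?M (\<Inter>n. ?E n)"
    by (rule P.finite_Lim_measure_decseq) (auto simp: decseq_def)
  ultimately have "(\<lambda>n. avoid K x n x) \<longlonglongrightarrow> measure ?M (\<Inter>n. ?E n)" by simp
  \<comment> \<open>The escape event does not prescribe the starting point, but
    \<open>\<omega> 0 = x\<close> holds almost surely.\<close>
  also have "measure ?M (\<Inter>n. ?E n) = measure ?M {\<omega>. \<forall>n>0. \<omega> n \<noteq> x}"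
  proof (rule P.finite_measure_eq_AE)
    have "AE \<omega> in ?M. \<omega> 0 = x"
      using start P.AE_in_set_eq_1[OF sets_chain_law_component[of "\<lambda>y. y = x" 0 K x]] by simp
    then show "AE \<omega> in ?M. (\<omega> \<in> (\<Inter>n. ?E n)) = (\<omega> \<in> {\<omega>. \<forall>n>0. \<omega> n \<noteq> x})"
      by eventually_elim auto
  qed (auto intro: sets_chain_law_pred)
  finally show ?thesis .
qed

lemma avoid_nonneg: "0 \<le> avoid K r n y"
  by (induction n arbitrary: y) (auto intro: sum_nonneg)

lemma avoid_le_1:
  assumes fin: "\<And>y. y \<in> V \<Longrightarrow> finite (set_pmf (K y))"
    and closed: "\<And>y. y \<in> V \<Longrightarrow> set_pmf (K y) \<subseteq> V"
    and "y \<in> V"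
  shows "avoid K r n y \<le> 1"
  using \<open>y \<in> V\<close>
proof (induction n arbitrary: y)
  case (Suc n)
  have "avoid K r (Suc n) y \<le> (\<Sum>z\<in>set_pmf (K y) - {r}. pmf (K y) z)"
    using Suc closed by (auto intro!: sum_mono mult_left_le)
  also have "\<dots> \<le> (\<Sum>z\<in>set_pmf (K y). pmf (K y) z)"
    using fin Suc.prems by (intro sum_mono2) auto
  also have "\<dots> = 1" using fin Suc.prems by (intro sum_pmf_eq_1) auto
  finally show ?case .
qed simp

lemma avoid_Suc_le:
  assumes fin: "\<And>y. y \<in> V \<Longrightarrow> finite (set_pmf (K y))"
    and closed: "\<And>y. y \<in> V \<Longrightarrow> set_pmf (K y) \<subseteq> V"
    and "y \<in> V"
  shows "avoid K r (Suc n) y \<le> avoid K r n y"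
  using \<open>y \<in> V\<close>
proof (induction n arbitrary: y)
  case 0
  then show ?case using avoid_le_1[where V = V and y = y and K = K and n = 1, OF fin closed] by simp
next
  case (Suc n)
  have "(\<Sum>z\<in>set_pmf (K y) - {r}. pmf (K y) z * avoid K r (Suc n) z)
    \<le> (\<Sum>z\<in>set_pmf (K y) - {r}. pmf (K y) z * avoid K r n z)"
    using Suc closed by (intro sum_mono mult_left_mono) auto
  then show ?case by simp
qed

section \<open>Acyclicity, descending paths and subtrees of a rooted tree\<close>

section \<open>Rooted trees\<close>

lemma finite_children:
  assumes "rooted_tree T" "locally_finite T"
  shows "finite (children T x)"
proof (cases "x \<in> verts T")
  case False
  then have "children T x = {}" using assms(1) by (auto simp: children_def rooted_tree_def)
  then show ?thesis by simp
qed (use assms in \<open>simp add: locally_finite_def\<close>)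

lemma children_subset_verts: "rooted_tree T \<Longrightarrow> children T x \<subseteq> verts T"
  by (auto simp: children_def rooted_tree_def)

lemma parent_unique:
  assumes "rooted_tree T" "(x, z) \<in> arcs T" "(y, z) \<in> arcs T"
  shows "x = y"
proof -
  have "z \<in> verts T - {root T}" using assms by (auto simp: rooted_tree_def)
  then have "\<exists>!x. (x, z) \<in> arcs T" using assms(1) unfolding rooted_tree_def by blast
  then show ?thesis using assms by blast
qed

text \<open>A cycle through a vertex also passes through its unique parent. Induction along the path
  from the root moves it up to the root, which has no parent.\<close>

lemma acyclic_arcs:
  assumes T: "rooted_tree T"
  shows "acyclic (arcs T)"
proof (rule acyclicI, rule allI)
  fix x
  show "(x, x) \<notin> (arcs T)\<^sup>+"
  proof
    assume cyc: "(x, x) \<in> (arcs T)\<^sup>+"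
    then have "x \<in> verts T" using T by (auto simp: rooted_tree_def dest: tranclD)
    then have "(root T, x) \<in> (arcs T)\<^sup>*" using T by (simp add: rooted_tree_def)
    then have "(x, x) \<notin> (arcs T)\<^sup>+"
    proof (induction rule: rtrancl_induct)
      case base
      show ?case using T by (auto simp: rooted_tree_def dest: tranclD2)
    next
      case (step y z)
      show ?case
      proof
        assume "(z, z) \<in> (arcs T)\<^sup>+"
        then obtain u where "(z, u) \<in> (arcs T)\<^sup>*" "(u, z) \<in> arcs T" by (meson tranclD2)
        with step parent_unique[OF T] have "(z, y) \<in> (arcs T)\<^sup>*" by blast
        with step show False by (meson rtrancl_into_trancl2)
      qed
    qed
    with cyc show False by blast
  qed
qed

lemma descending_path_inj:
  assumes T: "rooted_tree T" and p: "\<And>n. (p n, p (Suc n)) \<in> arcs T"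
  shows "inj p"
proof (rule linorder_injI)
  fix i j :: nat assume "i < j"
  then have "(p i, p j) \<in> (arcs T)\<^sup>+"
  proof (induction j)
    case (Suc j)
    then show ?case using p[of j] by (cases "i = j") (auto intro: trancl_into_trancl)
  qed simp
  then show "p i \<noteq> p j" using acyclic_arcs[OF T] by (auto simp: acyclic_def)
qed

text \<open>Acyclicity makes descending paths self-avoiding; cutsets enter the flow argument in this
  form.\<close>

lemma V_cutset_meets_descending_path:
  assumes "rooted_tree T" "V_cutset T A" "p 0 = root T" "\<And>n. (p n, p (Suc n)) \<in> arcs T"
  shows "\<exists>n. p n \<in> A"
  using assms descending_path_inj[where p = p, OF assms(1,4)]
  by (auto simp: V_cutset_def infinite_sa_path_def)

lemma children_subtree:
  "x \<in> descendants T v \<Longrightarrow> children (subtree T v) x = children T x"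
  by (auto simp: children_def subtree_def descendants_def intro: rtrancl_into_rtrancl)

lemma root_subtree [simp]: "root (subtree T v) = v"
  by (simp add: subtree_def)

lemma rooted_tree_subtree:
  assumes T: "rooted_tree T"
  shows "rooted_tree (subtree T v)"
proof -
  let ?D = "descendants T v" and ?A = "arcs T \<inter> (descendants T v \<times> descendants T v)"
  have v: "v \<in> ?D" by (simp add: descendants_def)
  have no_parent: "(x, v) \<notin> ?A" for x
  proof
    assume "(x, v) \<in> ?A"
    then have "(v, v) \<in> (arcs T)\<^sup>+" by (auto simp: descendants_def intro: rtrancl_into_trancl1)
    then show False using acyclic_arcs[OF T] by (auto simp: acyclic_def)
  qed
  have parent: "\<exists>!x. (x, y) \<in> ?A" if "y \<in> ?D - {v}" for y
  proof -
    have "(v, y) \<in> (arcs T)\<^sup>*" "v \<noteq> y" using that by (auto simp: descendants_def)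
    then obtain x where "(v, x) \<in> (arcs T)\<^sup>*" "(x, y) \<in> arcs T" by (metis rtranclE)
    then have "(x, y) \<in> ?A" using that by (auto simp: descendants_def)
    then show ?thesis using parent_unique[OF T] by blast
  qed
  have reach: "(v, y) \<in> ?A\<^sup>*" if "y \<in> ?D" for y
  proof -
    have "(v, y) \<in> (arcs T)\<^sup>*" using that by (simp add: descendants_def)
    then show ?thesis
    proof (induction rule: rtrancl_induct)
      case (step y z)
      then have "(y, z) \<in> ?A" by (auto simp: descendants_def intro: rtrancl_into_rtrancl)
      with step show ?case by (meson rtrancl_into_rtrancl)
    qed simp
  qed
  show ?thesis using v no_parent parent reach by (auto simp: rooted_tree_def subtree_def)
qed

lemma locally_finite_subtree:
  assumes "rooted_tree T" "locally_finite T"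
  shows "locally_finite (subtree T v)"
  using children_subtree[of _ T v] finite_children[OF assms]
  by (simp add: locally_finite_def subtree_def)

section \<open>Series and parallel laws: finite approximations and their decreasing limit\<close>

section \<open>The tree recursion for effective conductances\<close>

text \<open>\<open>branch l T y\<close> is the conductance of the branch consisting of \<open>y\<close>, everything below it, and
  a unit edge from the parent of \<open>y\<close>; equally, the probability that the walk from \<open>y\<close> never reaches
  the parent.  The \<open>n\<close>-th approximation shorts all vertices \<open>n\<close> generations below \<open>y\<close> to infinity.\<close>

primrec branch_approx :: "real \<Rightarrow> 'a rtree \<Rightarrow> nat \<Rightarrow> 'a \<Rightarrow> real" where
  "branch_approx l T 0 y = 1"
| "branch_approx l T (Suc n) y =
     (let s = l * (\<Sum>z\<in>children T y. branch_approx l T n z) in s / (1 + s))"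

definition branch :: "real \<Rightarrow> 'a rtree \<Rightarrow> 'a \<Rightarrow> real" where
  "branch l T y = lim (\<lambda>n. branch_approx l T n y)"

text \<open>By the parallel law this is the conductance from \<open>x\<close> to infinity inside its
  subtree, with unit edges at \<open>x\<close>.\<close>

definition below_conductance :: "real \<Rightarrow> 'a rtree \<Rightarrow> 'a \<Rightarrow> real" where
  "below_conductance l T x = (\<Sum>y\<in>children T x. branch l T y)"

lemma frac_mono: "0 \<le> (s::real) \<Longrightarrow> s \<le> t \<Longrightarrow> s / (1 + s) \<le> t / (1 + t)"
  by (simp add: field_simps)

text \<open>The right side solves a first-step equation \<open>(1 + s) * u = h + s\<close>. The left
  side reads it as never going up, or going up and then succeeding with chance
  \<open>h\<close>.\<close>

lemma frac_average:
  "0 < 1 + (s::real) \<Longrightarrow> s / (1 + s) + (1 - s / (1 + s)) * h = (h + s) / (1 + s)"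
proof -
  assume "0 < 1 + s"
  then have "1 - s / (1 + s) = 1 / (1 + s)" by (simp add: field_simps)
  then show ?thesis by (simp only:) (simp add: add_divide_distrib)
qed

lemma branch_approx_nonneg: "0 < l \<Longrightarrow> 0 \<le> branch_approx l T n y"
  by (induction n arbitrary: y) (auto simp: Let_def intro!: divide_nonneg_nonneg sum_nonneg
      add_nonneg_nonneg mult_nonneg_nonneg)

lemma branch_approx_sum_nonneg: "0 < l \<Longrightarrow> 0 \<le> l * (\<Sum>z\<in>A. branch_approx l T n z)"
  by (simp add: sum_nonneg branch_approx_nonneg)

lemma branch_approx_le_1: "0 < l \<Longrightarrow> branch_approx l T n y \<le> 1"
  using branch_approx_sum_nonneg[of l T "n - 1" "children T y"]
  by (cases n) (auto simp: Let_def)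

lemma branch_approx_Suc_le: "0 < l \<Longrightarrow> branch_approx l T (Suc n) y \<le> branch_approx l T n y"
proof (induction n arbitrary: y)
  case 0
  then show ?case using branch_approx_le_1[of l T "Suc 0" y] by simp
next
  case (Suc n)
  then have "l * (\<Sum>z\<in>children T y. branch_approx l T (Suc n) z)
      \<le> l * (\<Sum>z\<in>children T y. branch_approx l T n z)"
    by (intro mult_left_mono sum_mono) auto
  from frac_mono[OF branch_approx_sum_nonneg[OF Suc.prems] this] show ?case
    by (simp only: branch_approx.simps Let_def)
qed

lemma branch_approx_mono:
  "0 < l \<Longrightarrow> l \<le> m \<Longrightarrow> branch_approx l T n y \<le> branch_approx m T n y"
proof (induction n arbitrary: y)
  case (Suc n)
  then have "l * (\<Sum>z\<in>children T y. branch_approx l T n z)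
      \<le> m * (\<Sum>z\<in>children T y. branch_approx m T n z)"
    by (intro mult_mono sum_mono) (auto intro!: sum_nonneg branch_approx_nonneg)
  from frac_mono[OF branch_approx_sum_nonneg[OF Suc.prems(1)] this] show ?case
    by (simp only: branch_approx.simps Let_def)
qed simp

lemma branch_approx_tendsto:
  assumes "0 < l"
  shows "(\<lambda>n. branch_approx l T n y) \<longlonglongrightarrow> branch l T y"
proof -
  have "decseq (\<lambda>n. branch_approx l T n y)"
    using assms by (intro decseq_SucI branch_approx_Suc_le)
  then have "convergent (\<lambda>n. branch_approx l T n y)"
    using assms branch_approx_nonneg by (metis decseq_convergent convergentI)
  then show ?thesis by (simp add: branch_def convergent_LIMSEQ_iff)
qed

lemma branch_nonneg: "0 < l \<Longrightarrow> 0 \<le> branch l T y"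
  using LIMSEQ_le_const[OF branch_approx_tendsto] branch_approx_nonneg by metis

lemma branch_le_1: "0 < l \<Longrightarrow> branch l T y \<le> 1"
  using LIMSEQ_le_const2[OF branch_approx_tendsto] branch_approx_le_1 by metis

lemma branch_mono: "0 < l \<Longrightarrow> l \<le> m \<Longrightarrow> branch l T y \<le> branch m T y"
  by (rule LIMSEQ_le[OF branch_approx_tendsto branch_approx_tendsto])
     (auto intro: branch_approx_mono)

lemma below_conductance_nonneg: "0 < l \<Longrightarrow> 0 \<le> below_conductance l T x"
  by (simp add: below_conductance_def sum_nonneg branch_nonneg)

lemma below_conductance_mono:
  "0 < l \<Longrightarrow> l \<le> m \<Longrightarrow> below_conductance l T x \<le> below_conductance m T x"
  by (simp add: below_conductance_def sum_mono branch_mono)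

text \<open>The recursion for \<open>branch_approx\<close> passes to the limit by continuity, the
  denominators staying at least 1.\<close>

lemma branch_eq:
  assumes l: "0 < l"
  shows "branch l T y = l * below_conductance l T y / (1 + l * below_conductance l T y)"
proof (rule LIMSEQ_unique)
  show "(\<lambda>n. branch_approx l T (Suc n) y) \<longlonglongrightarrow> branch l T y"
    using branch_approx_tendsto[OF l] by (rule LIMSEQ_Suc)
  have "0 \<le> l * below_conductance l T y" using l by (simp add: below_conductance_nonneg)
  then show "(\<lambda>n. branch_approx l T (Suc n) y)
      \<longlonglongrightarrow> l * below_conductance l T y / (1 + l * below_conductance l T y)"
    unfolding branch_approx.simps Let_def below_conductance_def
    by (intro tendsto_intros branch_approx_tendsto l) simp
qed

lemma branch_subtree:
  assumes "y \<in> descendants T v"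
  shows "branch l (subtree T v) y = branch l T y"
proof -
  have "branch_approx l (subtree T v) n y = branch_approx l T n y" for n
    using assms
  proof (induction n arbitrary: y)
    case (Suc n)
    have "z \<in> descendants T v" if "z \<in> children T y" for z
      using that Suc.prems by (auto simp: children_def descendants_def intro: rtrancl_into_rtrancl)
    then have "(\<Sum>z\<in>children T y. branch_approx l (subtree T v) n z) =
        (\<Sum>z\<in>children T y. branch_approx l T n z)"
      using Suc.IH by (intro sum.cong) auto
    then show ?case using Suc.prems by (simp add: children_subtree)
  qed simp
  then show ?thesis by (simp add: branch_def)
qed

text \<open>Uniform transience speaks of walks on \<open>subtree T v\<close>, while the recursion
  runs in \<open>T\<close>; this links the two.\<close>

lemma below_conductance_subtree:
  "below_conductance l (subtree T v) v = below_conductance l T v"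
proof -
  have v: "v \<in> descendants T v" by (simp add: descendants_def)
  have "y \<in> descendants T v" if "y \<in> children T v" for y
    using that by (auto simp: children_def descendants_def)
  then show ?thesis
    unfolding below_conductance_def children_subtree[OF v] by (simp add: branch_subtree)
qed

section \<open>First-step analysis of the walk, identifying conductance with escape\<close>

section \<open>Escape probabilities solve the recursion\<close>


text \<open>The state \<open>y\<close> itself is listed because a childless root holds the walk in
  place.\<close>

lemma set_pmf_rw_step:
  assumes T: "rooted_tree T" "locally_finite T" and l: "0 < l" and y: "y \<in> verts T"
  shows "set_pmf (rw_step l T y) \<subseteq> insert y (children T y \<union> {p. (p, y) \<in> arcs T})"
proof (cases "y = root T")
  case True
  then show ?thesis
    using finite_children[OF T, of y] by (auto simp: rw_step_def set_pmf_of_set split: if_splits)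
next
  case False
  then show ?thesis
    using pmf_rw_step[OF T y False l]
    by (auto simp: set_pmf_iff children_def split: if_splits)
qed

lemma rw_step_closed:
  assumes T: "rooted_tree T" "locally_finite T" and l: "0 < l" and y: "y \<in> verts T"
  shows "finite (set_pmf (rw_step l T y))" "set_pmf (rw_step l T y) \<subseteq> verts T"
proof -
  have "\<exists>p. {q. (q, y) \<in> arcs T} \<subseteq> {p}"
    using parent_unique[OF T(1)] by blast
  then have "finite {p. (p, y) \<in> arcs T}" by (auto intro: finite_subset)
  then show "finite (set_pmf (rw_step l T y))"
    using finite_subset[OF set_pmf_rw_step[OF assms]] finite_children[OF T] by simp
  show "set_pmf (rw_step l T y) \<subseteq> verts T"
    using set_pmf_rw_step[OF assms] y T(1) by (auto simp: children_def rooted_tree_def)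
qed

text \<open>First-step analysis with denominators cleared. The parent contributes 0 when it is the
  root, since stepping there is failure.\<close>

lemma avoid_rw_step:
  assumes T: "rooted_tree T" "locally_finite T" and l: "0 < l" and p: "(p, y) \<in> arcs T"
  shows "(1 + real (card (children T y)) * l) * avoid (rw_step l T) (root T) (Suc n) y =
    (if p = root T then 0 else avoid (rw_step l T) (root T) n p) +
    l * (\<Sum>z\<in>children T y. avoid (rw_step l T) (root T) n z)"
proof -
  let ?K = "rw_step l T" and ?r = "root T" and ?D = "1 + real (card (children T y)) * l"
  let ?h = "\<lambda>z. if z = ?r then 0 else avoid ?K ?r n z"
  have y: "y \<in> verts T" "y \<noteq> ?r" using T(1) p by (auto simp: rooted_tree_def)
  have D: "?D > 0" using l by (simp add: add_pos_nonneg)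
  have fin: "finite (children T y)" by (rule finite_children[OF T])
  have child: "z \<noteq> ?r" "(z, y) \<notin> arcs T" if "z \<in> children T y" for z
  proof -
    show "z \<noteq> ?r" using that T(1) by (auto simp: children_def rooted_tree_def)
    show "(z, y) \<notin> arcs T"
      using that acyclic_arcs[OF T(1)] unfolding children_def acyclic_def
      by (metis mem_Collect_eq r_into_trancl trancl_into_trancl)
  qed
  have pC: "p \<notin> children T y" using child p by blast
  have sub: "set_pmf (?K y) \<subseteq> insert p (children T y)"
    using pmf_rw_step[OF T y l] parent_unique[OF T(1) p]
    by (auto simp: set_pmf_iff children_def split: if_splits)
  have "avoid ?K ?r (Suc n) y = (\<Sum>z\<in>set_pmf (?K y) - {?r}. pmf (?K y) z * ?h z)"
    by simp
  \<comment> \<open>Outside the support the weights vanish, and \<open>?h\<close> vanishes at the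
    root, so the index set may be changed.\<close>
  also have "\<dots> = (\<Sum>z\<in>insert p (children T y). pmf (?K y) z * ?h z)"
    using sub fin by (intro sum.mono_neutral_left) (auto simp: set_pmf_iff)
  also have "\<dots> = pmf (?K y) p * ?h p + (\<Sum>z\<in>children T y. pmf (?K y) z * ?h z)"
    using fin pC by simp
  also have "(\<Sum>z\<in>children T y. pmf (?K y) z * ?h z) =
      (\<Sum>z\<in>children T y. l / ?D * avoid ?K ?r n z)"
    using child by (intro sum.cong) (auto simp: pmf_rw_step[OF T y l] children_def)
  also have "\<dots> = l / ?D * (\<Sum>z\<in>children T y. avoid ?K ?r n z)" by (rule sum_distrib_left[symmetric])
  also have "pmf (?K y) p = 1 / ?D" using p by (simp add: pmf_rw_step[OF T y l])
  also have "1 / ?D * ?h p + l / ?D * (\<Sum>z\<in>children T y. avoid ?K ?r n z) =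
      (?h p + l * (\<Sum>z\<in>children T y. avoid ?K ?r n z)) / ?D"
    by (simp add: add_divide_distrib)
  finally show ?thesis using D by (simp only: nonzero_mult_div_cancel_left times_divide_eq_right)
qed

lemma avoid_rw_step_root:
  assumes T: "rooted_tree T" "locally_finite T"
  shows "real (card (children T (root T))) * avoid (rw_step l T) (root T) (Suc n) (root T) =
    (\<Sum>z\<in>children T (root T). avoid (rw_step l T) (root T) n z)"
proof (cases "children T (root T) = {}")
  case False
  have fin: "finite (children T (root T))" by (rule finite_children[OF T])
  have "root T \<notin> children T (root T)" using T(1) by (auto simp: children_def rooted_tree_def)
  then show ?thesis
    using False fin by (simp add: rw_step_def sum_distrib_left)
qed simp

text \<open>Avoiding the root from \<open>y\<close> means either never stepping up to the parent \<open>p\<close>, or avoiding it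
  from \<open>p\<close>.  Proved as two inequalities, this decomposition needs no strong Markov property.\<close>

lemma avoid_ge_branch:
  assumes T: "rooted_tree T" "locally_finite T" and l: "0 < l" and p: "(p, y) \<in> arcs T"
  shows "branch l T y + (1 - branch l T y) *
      (if p = root T then 0 else avoid (rw_step l T) (root T) n p)
    \<le> avoid (rw_step l T) (root T) n y"
  using p
proof (induction n arbitrary: p y)
  case 0
  then show ?case using branch_le_1[OF l, of T y] by simp
next
  case (Suc n)
  let ?u = "avoid (rw_step l T) (root T)" and ?C = "below_conductance l T y"
  let ?h = "\<lambda>n. if p = root T then 0 else ?u n p" and ?k = "real (card (children T y))"
  have verts: "p \<in> verts T" "y \<in> verts T" using Suc.prems T(1) by (auto simp: rooted_tree_def)
  have y: "y \<noteq> root T" using Suc.prems T(1) by (auto simp: rooted_tree_def)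
  note step = rw_step_closed[OF T l]
  \<comment> \<open>The induction hypothesis bounds the children through \<open>?u n y\<close>.
    Monotonicity in time, with the nonnegative coefficient \<open>?k - ?C\<close>, replaces this by
    \<open>?u (Suc n) y\<close>, and the inequality can be solved for that single unknown.\<close>
  have u_y: "?u (Suc n) y \<le> ?u n y"
    by (rule avoid_Suc_le[where V = "verts T"]) (use step verts in auto)
  have u_p: "?h (Suc n) \<le> ?h n"
    using avoid_Suc_le[where V = "verts T" and y = p and K = "rw_step l T", OF step] verts by auto
  have C0: "0 \<le> ?C" using l by (rule below_conductance_nonneg)
  have Ck: "?C \<le> ?k"
    unfolding below_conductance_def
    using sum_mono[of "children T y" "branch l T" "\<lambda>_. 1"] by (simp add: branch_le_1 l)
  have "(\<Sum>z\<in>children T y. branch l T z + (1 - branch l T z) * ?u n y)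
      \<le> (\<Sum>z\<in>children T y. ?u n z)"
  proof (rule sum_mono)
    fix z assume "z \<in> children T y"
    then have "(y, z) \<in> arcs T" by (simp add: children_def)
    from Suc.IH[OF this] show "branch l T z + (1 - branch l T z) * ?u n y \<le> ?u n z"
      using y by simp
  qed
  moreover have "(\<Sum>z\<in>children T y. branch l T z + (1 - branch l T z) * ?u n y) =
      ?C + (?k - ?C) * ?u n y"
    by (simp add: below_conductance_def sum.distrib sum_distrib_right[symmetric] sum_subtractf)
  moreover have "(?k - ?C) * ?u (Suc n) y \<le> (?k - ?C) * ?u n y"
    using u_y Ck by (intro mult_left_mono) auto
  ultimately have "l * (?C + (?k - ?C) * ?u (Suc n) y) \<le> l * (\<Sum>z\<in>children T y. ?u n z)"
    using l by (intro mult_left_mono) auto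
  then have "?h (Suc n) + l * (?C + (?k - ?C) * ?u (Suc n) y) \<le> (1 + ?k * l) * ?u (Suc n) y"
    using u_p avoid_rw_step[OF T l Suc.prems, of n] by simp
  then have "?h (Suc n) + l * ?C \<le> (1 + l * ?C) * ?u (Suc n) y"
    by (simp add: algebra_simps)
  moreover have pos: "0 < 1 + l * ?C" using C0 l by (simp add: add_pos_nonneg)
  ultimately have "(?h (Suc n) + l * ?C) / (1 + l * ?C) \<le> ?u (Suc n) y"
    by (simp add: divide_le_eq mult.commute)
  moreover have "branch l T y + (1 - branch l T y) * ?h (Suc n) =
      (?h (Suc n) + l * ?C) / (1 + l * ?C)"
    using frac_average[OF pos] unfolding branch_eq[OF l, of T y] by simp
  ultimately show ?case by simp
qed

text \<open>The reverse inequality, for the limit \<open>h\<close>, which solves the first-step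
  equation exactly. The induction is on the truncation level of the branch instead of on time,
  starting from \<open>h y \<le> 1\<close>.\<close>

lemma avoid_limit_le_branch_approx:
  assumes T: "rooted_tree T" "locally_finite T" and l: "0 < l"
    and lim: "\<And>y. y \<in> verts T \<Longrightarrow> (\<lambda>n. avoid (rw_step l T) (root T) n y) \<longlonglongrightarrow> h y"
    and p: "(p, y) \<in> arcs T"
  shows "h y \<le> branch_approx l T n y +
    (1 - branch_approx l T n y) * (if p = root T then 0 else h p)"
  using p
proof (induction n arbitrary: p y)
  case 0
  have "y \<in> verts T" using 0 T(1) by (auto simp: rooted_tree_def)
  then have "h y \<le> 1"
    using avoid_le_1[where V = "verts T" and y = y and K = "rw_step l T", OF rw_step_closed[OF T l]]
    by (intro LIMSEQ_le_const2[OF lim]) auto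
  then show ?case by simp
next
  case (Suc n)
  let ?u = "avoid (rw_step l T) (root T)" and ?k = "real (card (children T y))"
  let ?s = "\<Sum>z\<in>children T y. branch_approx l T n z"
  let ?h = "if p = root T then 0 else h p"
  have verts: "p \<in> verts T" "y \<in> verts T" using Suc.prems T(1) by (auto simp: rooted_tree_def)
  have y: "y \<noteq> root T" using Suc.prems T(1) by (auto simp: rooted_tree_def)
  have s0: "0 \<le> l * ?s" using l by (rule branch_approx_sum_nonneg)
  have "(\<lambda>n. (1 + ?k * l) * ?u (Suc n) y) \<longlonglongrightarrow> (1 + ?k * l) * h y"
    using LIMSEQ_Suc[OF lim] verts by (intro tendsto_intros) auto
  moreover have "(\<lambda>n. (if p = root T then 0 else ?u n p) + l * (\<Sum>z\<in>children T y. ?u n z))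
      \<longlonglongrightarrow> ?h + l * (\<Sum>z\<in>children T y. h z)"
    using lim verts children_subset_verts[OF T(1)] by (cases "p = root T") (auto intro!: tendsto_intros)
  ultimately have eq: "(1 + ?k * l) * h y = ?h + l * (\<Sum>z\<in>children T y. h z)"
    unfolding avoid_rw_step[OF T l Suc.prems] by (rule LIMSEQ_unique)
  have "(\<Sum>z\<in>children T y. h z)
      \<le> (\<Sum>z\<in>children T y. branch_approx l T n z + (1 - branch_approx l T n z) * h y)"
  proof (rule sum_mono)
    fix z assume "z \<in> children T y"
    then have "(y, z) \<in> arcs T" by (simp add: children_def)
    from Suc.IH[OF this]
    show "h z \<le> branch_approx l T n z + (1 - branch_approx l T n z) * h y" using y by simp
  qed
  also have "\<dots> = ?s + (?k - ?s) * h y"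
    by (simp add: sum.distrib sum_distrib_right[symmetric] sum_subtractf)
  finally have "(1 + ?k * l) * h y \<le> ?h + l * (?s + (?k - ?s) * h y)"
    using eq l by simp
  then have "(1 + l * ?s) * h y \<le> ?h + l * ?s"
    by (simp add: algebra_simps)
  moreover have pos: "0 < 1 + l * ?s" using s0 by simp
  ultimately have "h y \<le> (?h + l * ?s) / (1 + l * ?s)"
    by (simp add: le_divide_eq mult.commute)
  also have "\<dots> = branch_approx l T (Suc n) y + (1 - branch_approx l T (Suc n) y) * ?h"
    using frac_average[OF pos] unfolding branch_approx.simps Let_def by simp
  finally show ?case .
qed

text \<open>For a child of the root the parent term is 0, so the two inequalities squeeze the
  avoidance limit to \<open>branch\<close>. A first step from the root then averages over the
  children.\<close>

lemma below_conductance_eq_escape: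
  assumes T: "rooted_tree T" "locally_finite T" and l: "0 < l"
  shows "below_conductance l T (root T) =
    real (card (children T (root T))) * escape_prob l T (root T)"
proof -
  let ?r = "root T" and ?u = "avoid (rw_step l T) (root T)"
  have r: "?r \<in> verts T" using T(1) by (simp add: rooted_tree_def)
  note step = rw_step_closed[OF T l]
  define h where "h y = lim (\<lambda>n. ?u n y)" for y
  have lim: "(\<lambda>n. ?u n y) \<longlonglongrightarrow> h y" if y: "y \<in> verts T" for y
  proof -
    have "decseq (\<lambda>n. ?u n y)"
      by (intro decseq_SucI avoid_Suc_le[where V = "verts T"]) (use step y in auto)
    then have "convergent (\<lambda>n. ?u n y)"
      by (metis decseq_convergent convergentI avoid_nonneg)
    then show ?thesis by (simp add: h_def convergent_LIMSEQ_iff)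
  qed
  have "h z = branch l T z" if z: "z \<in> children T ?r" for z
  proof (rule antisym)
    have arc: "(?r, z) \<in> arcs T" using z by (simp add: children_def)
    show "branch l T z \<le> h z"
      using avoid_ge_branch[OF T l arc] z children_subset_verts[OF T(1)]
      by (intro LIMSEQ_le_const[OF lim]) auto
    show "h z \<le> branch l T z"
      using avoid_limit_le_branch_approx[where h = h, OF T l lim arc]
      by (intro LIMSEQ_le_const[OF branch_approx_tendsto[OF l]]) auto
  qed
  then have C: "below_conductance l T ?r = (\<Sum>z\<in>children T ?r. h z)"
    by (simp add: below_conductance_def)
  have "(\<lambda>n. real (card (children T ?r)) * ?u (Suc n) ?r)
      \<longlonglongrightarrow> real (card (children T ?r)) * escape_prob l T ?r"
    unfolding escape_prob_def rw_law_def
    using avoid_tendsto_escape[where V = "verts T" and x = ?r and K = "rw_step l T", OF step r]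
    by (intro tendsto_intros LIMSEQ_Suc)
  moreover have "(\<lambda>n. \<Sum>z\<in>children T ?r. ?u n z) \<longlonglongrightarrow> (\<Sum>z\<in>children T ?r. h z)"
    using lim children_subset_verts[OF T(1)] by (intro tendsto_sum) auto
  ultimately show ?thesis
    unfolding C avoid_rw_step_root[OF T] by (metis LIMSEQ_unique)
qed

lemma effective_conductance_eq:
  assumes T: "rooted_tree T" "locally_finite T" and l: "0 < l"
  shows "effective_conductance l T = below_conductance l T (root T)"
proof -
  have "depth T (root T) = 0"
    unfolding depth_def by (rule Least_eq_0) simp
  then show ?thesis
    by (simp add: effective_conductance_def conductance_def below_conductance_eq_escape[OF assms])
qed

text \<open>The right side is the escape probability times the number of children. A childless
  \<open>v\<close> holds the walk, so positive escape forces at least one child.\<close>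

lemma escape_le_below_conductance:
  assumes T: "rooted_tree T" "locally_finite T" and l: "0 < l"
    and pos: "0 < escape_prob l (subtree T v) v"
  shows "escape_prob l (subtree T v) v \<le> below_conductance l T v"
proof -
  let ?S = "subtree T v"
  note S = rooted_tree_subtree[OF T(1), of v] locally_finite_subtree[OF T, of v]
  have v: "v \<in> verts ?S" by (simp add: subtree_def descendants_def)
  have "children ?S v \<noteq> {}"
  proof
    assume "children ?S v = {}"
    then have "rw_step l ?S v = return_pmf v" by (simp add: rw_step_def)
    \<comment> \<open>The shift to \<open>Suc n\<close> matters: \<open>avoid\<close> is 1 at time
      0.\<close>
    then have "avoid (rw_step l ?S) v (Suc n) v = 0" for n by simp
    moreover have "(\<lambda>n. avoid (rw_step l ?S) v (Suc n) v) \<longlonglongrightarrow> escape_prob l ?S v"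
      unfolding escape_prob_def rw_law_def
      by (rule LIMSEQ_Suc, rule avoid_tendsto_escape[where V = "verts ?S"])
         (use rw_step_closed[OF S l] v in auto)
    ultimately have "escape_prob l ?S v = 0" by (simp add: LIMSEQ_const_iff)
    then show False using pos by simp
  qed
  then have "1 \<le> card (children ?S v)"
    using finite_children[OF S, of v] by (simp add: Suc_le_eq card_gt_0_iff)
  then have "1 * escape_prob l ?S v \<le> real (card (children ?S v)) * escape_prob l ?S v"
    using pos by (intro mult_right_mono) auto
  also have "\<dots> = below_conductance l T v"
    using below_conductance_eq_escape[OF S l] by (simp add: below_conductance_subtree)
  finally show ?thesis by simp
qed

section \<open>Flows, cutsets and the energy bound\<close>

section \<open>Uniqueness for the recursion\<close>

text \<open>A truncated Green operator: \<open>f\<close> summed over the descendants fewer than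
  \<open>n\<close> generations below \<open>x\<close>, each weighted by the product of
  \<open>k\<close> along the path from \<open>x\<close>, with \<open>x\<close> itself excluded from
  the product.\<close>

primrec potential :: "'a rtree \<Rightarrow> ('a \<Rightarrow> real) \<Rightarrow> ('a \<Rightarrow> real) \<Rightarrow> nat \<Rightarrow> 'a \<Rightarrow> real" where
  "potential T k f 0 x = 0"
| "potential T k f (Suc n) x = f x + (\<Sum>y\<in>children T x. k y * potential T k f n y)"

lemma potential_mono:
  assumes "\<And>x. 0 \<le> k x" "\<And>x. f x \<le> g x"
  shows "potential T k f n x \<le> potential T k g n x"
  by (induction n arbitrary: x) (auto intro!: add_mono sum_mono mult_left_mono assms)

lemma potential_cmult: "potential T k (\<lambda>x. c * f x) n x = c * potential T k f n x"
  by (induction n arbitrary: x) (simp_all add: algebra_simps sum_distrib_left)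

lemma potential_sum:
  "potential T k (\<lambda>x. \<Sum>i\<in>I. f i x) n x = (\<Sum>i\<in>I. potential T k (f i) n x)"
proof (induction n arbitrary: x)
  case (Suc n)
  have "(\<Sum>y\<in>children T x. k y * (\<Sum>i\<in>I. potential T k (f i) n y)) =
      (\<Sum>i\<in>I. \<Sum>y\<in>children T x. k y * potential T k (f i) n y)"
    unfolding sum_distrib_left by (rule sum.swap)
  then show ?case by (simp add: Suc sum.distrib)
qed simp

lemma potential_incseq:
  assumes "\<And>x. 0 \<le> k x" "\<And>x. 0 \<le> f x"
  shows "incseq (\<lambda>n. potential T k f n x)"
proof (rule incseq_SucI)
  fix n show "potential T k f n x \<le> potential T k f (Suc n) x"
  proof (induction n arbitrary: x)
    case 0
    then show ?case using assms by simp
  next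
    case (Suc n)
    then have "(\<Sum>y\<in>children T x. k y * potential T k f n y)
        \<le> (\<Sum>y\<in>children T x. k y * potential T k f (Suc n) y)"
      by (intro sum_mono mult_left_mono assms)
    then show ?case by simp
  qed
qed

text \<open>If the flow \<open>d\<close> exceeded what the cutset absorbs, the excess could be followed along an
  infinite path that avoids the cutset.\<close>

lemma flow_absorbed_by_cutset:
  assumes T: "rooted_tree T" "locally_finite T" and A: "V_cutset T A"
    and k: "\<And>x. 0 \<le> k x" and d: "\<And>x. 0 \<le> d x"
    and flow: "\<And>x. d x = (\<Sum>y\<in>children T x. k y * d y)"
  shows "\<exists>n. d (root T) \<le> potential T k (\<lambda>x. indicator A x * d x) n (root T)"
proof (rule ccontr)
  let ?f = "\<lambda>x. indicator A x * d x"
  let ?bad = "\<lambda>x. \<forall>n. potential T k ?f n x < d x"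
  have f: "0 \<le> ?f x" for x using d by simp
  assume "\<not> ?thesis"
  then have bad_root: "?bad (root T)" by (simp add: not_le)
  have bad_child: "\<exists>y. ?bad y \<and> (x, y) \<in> arcs T" if bad: "?bad x" for x
  proof (rule ccontr)
    assume "\<not> ?thesis"
    then have "\<forall>y\<in>children T x. \<exists>n. d y \<le> potential T k ?f n y"
      by (auto simp: children_def not_less)
    then obtain n where n: "\<And>y. y \<in> children T x \<Longrightarrow> d y \<le> potential T k ?f (n y) y" by metis
    \<comment> \<open>Finiteness of the set of children gives one truncation level for all of them;
      flow balance then makes \<open>x\<close> itself good.\<close>
    define N where "N = Max (n ` children T x)"
    have "d y \<le> potential T k ?f N y" if "y \<in> children T x" for y
    proof -
      have "n y \<le> N" unfolding N_def using that finite_children[OF T] by simp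
      then show ?thesis
        using n[OF that] incseqD[OF potential_incseq[of k ?f T y, OF k f]] by fastforce
    qed
    then have "d x \<le> (\<Sum>y\<in>children T x. k y * potential T k ?f N y)"
      unfolding flow[of x] by (intro sum_mono mult_left_mono k)
    also have "\<dots> \<le> potential T k ?f (Suc N) x" using f by simp
    finally show False using bad by (meson not_le)
  qed
  have "\<exists>p. \<forall>n. (?bad (p n) \<and> (n = 0 \<longrightarrow> p n = root T)) \<and> (p n, p (Suc n)) \<in> arcs T"
  proof (rule dependent_nat_choice)
    show "\<exists>x. ?bad x \<and> (0 = (0::nat) \<longrightarrow> x = root T)" using bad_root by simp
    show "\<exists>y. (?bad y \<and> (Suc n = 0 \<longrightarrow> y = root T)) \<and> (x, y) \<in> arcs T"
      if "?bad x \<and> (n = 0 \<longrightarrow> x = root T)" for x n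
      using bad_child[of x] that by simp
  qed
  then obtain p where
    "\<forall>n. (?bad (p n) \<and> (n = 0 \<longrightarrow> p n = root T)) \<and> (p n, p (Suc n)) \<in> arcs T" ..
  then have p: "p 0 = root T" "\<And>n. ?bad (p n)" "\<And>n. (p n, p (Suc n)) \<in> arcs T"
    by simp_all
  obtain n where "p n \<in> A" using V_cutset_meets_descending_path[OF T(1) A p(1,3)] by blast
  \<comment> \<open>On the cutset the single term \<open>f (p n)\<close> already equals
    \<open>d (p n)\<close>.\<close>
  then have "d (p n) \<le> potential T k ?f (Suc 0) (p n)" by simp
  then show False using p(2) by (meson not_le)
qed

text \<open>The deterministic core, applied with \<open>a\<close> the left limit of the conductances
  and \<open>c\<close> their value. Each of N disjoint cutsets absorbs the full
  \<open>d (root T)\<close>, but a single energy budget pays for all of them.\<close>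

lemma recursion_unique:
  fixes a c :: "'a \<Rightarrow> real" and A :: "nat \<Rightarrow> 'a set"
  assumes T: "rooted_tree T" "locally_finite T" and l: "0 < l"
    and cut: "\<And>n. V_cutset T (A n)" and disj: "disjoint_family A"
    and a0: "\<And>x. 0 \<le> a x" and ac: "\<And>x. a x \<le> c x"
    and a: "\<And>x. a x = (\<Sum>y\<in>children T x. l * a y / (1 + l * a y))"
    and c: "\<And>x. c x = (\<Sum>y\<in>children T x. l * c y / (1 + l * c y))"
    and \<alpha>: "0 < \<alpha>" "\<And>n v. v \<in> A n \<Longrightarrow> \<alpha> \<le> a v"
  shows "a (root T) = c (root T)"
proof -
  let ?r = "root T"
  \<comment> \<open>The difference quotient of \<open>s \<mapsto> l * s / (1 + l * s)\<close>
    between \<open>a y\<close> and \<open>c y\<close>.\<close>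
  define k where "k y = l / ((1 + l * a y) * (1 + l * c y))" for y
  define d where "d y = c y - a y" for y
  have c0: "0 \<le> c x" for x using a0[of x] ac[of x] by simp
  have pos: "0 < 1 + l * a x" "0 < 1 + l * c x" for x
    using l a0 c0 by (simp_all add: add_pos_nonneg)
  have k: "0 \<le> k x" for x
    using l pos by (simp add: k_def less_imp_le)
  have d: "0 \<le> d x" for x using ac by (simp add: d_def)
  have flow: "d x = (\<Sum>y\<in>children T x. k y * d y)" for x
  proof -
    have "k y * d y = l * c y / (1 + l * c y) - l * a y / (1 + l * a y)" for y
      using pos[of y] by (simp add: k_def d_def field_simps)
    then show ?thesis by (simp add: d_def a[of x] c[of x] sum_subtractf)
  qed
  \<comment> \<open>\<open>k\<close>-weighted, \<open>c\<close> is a superflow that loses \<open>l * a y * c y\<close> at each \<open>y\<close>: this is the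
    dissipated energy.\<close>
  have energy: "potential T k (\<lambda>x. l * a x * c x) n x \<le> (1 + l * a x) * c x" for n x
  proof (induction n arbitrary: x)
    case 0
    then show ?case using pos c0 by (simp add: less_imp_le)
  next
    case (Suc n)
    have "(\<Sum>y\<in>children T x. k y * potential T k (\<lambda>x. l * a x * c x) n y)
        \<le> (\<Sum>y\<in>children T x. k y * ((1 + l * a y) * c y))"
      by (intro sum_mono mult_left_mono Suc k)
    also have "\<dots> = (\<Sum>y\<in>children T x. l * c y / (1 + l * c y))"
      using pos[THEN less_imp_neq] by (intro sum.cong) (auto simp: k_def)
    also have "\<dots> = c x" by (rule c[symmetric])
    finally show ?case by (simp add: algebra_simps)
  qed
  \<comment> \<open>The energy bound at the root divided by \<open>l * \<alpha>\<close>; it does not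
    depend on \<open>N\<close>.\<close>
  define B where "B = (1 + l * a ?r) * c ?r / (l * \<alpha>)"
  have "real N * d ?r \<le> B" for N
  proof -
    let ?f = "\<lambda>i x. indicator (A i) x * d x"
    have f: "0 \<le> ?f i x" for i x using d by simp
    obtain m where m: "\<And>i. d ?r \<le> potential T k (?f i) (m i) ?r"
      using flow_absorbed_by_cutset[OF T cut k d flow] by metis
    define M where "M = Max (m ` {..<N})"
    have M: "d ?r \<le> potential T k (?f i) M ?r" if "i < N" for i
    proof -
      have "m i \<le> M" unfolding M_def using that by simp
      then show ?thesis
        using m[of i] incseqD[OF potential_incseq[of k "?f i" T ?r, OF k f]] by fastforce
    qed
    \<comment> \<open>By disjointness at most one indicator is nonzero at \<open>x\<close>, and
      there \<open>d x \<le> c x \<le> a x / \<alpha> * c x\<close>.\<close>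
    have le: "(\<Sum>i<N. ?f i x) \<le> 1 / (l * \<alpha>) * (l * a x * c x)" for x
    proof (cases "\<exists>i<N. x \<in> A i")
      case True
      then obtain i where i: "i < N" "x \<in> A i" by blast
      then have "x \<in> A j \<longleftrightarrow> j = i" for j
        using disj by (auto simp: disjoint_family_on_def)
      then have "(\<Sum>i<N. ?f i x) = (\<Sum>j<N. if j = i then d x else 0)"
        by (intro sum.cong) (simp_all add: indicator_def)
      also have "\<dots> = d x" using i by simp
      also have "\<dots> \<le> 1 * c x" using a0 by (simp add: d_def)
      also have "\<dots> \<le> a x / \<alpha> * c x"
        using \<alpha>(1) \<alpha>(2)[OF i(2)] c0 by (intro mult_right_mono) auto
      finally show ?thesis using l by simp
    next
      case False
      then have "(\<Sum>i<N. ?f i x) = 0" by (intro sum.neutral) auto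
      also have "0 \<le> 1 / (l * \<alpha>) * (l * a x * c x)" using l \<alpha>(1) a0 c0 by simp
      finally show ?thesis .
    qed
    have "real N * d ?r = (\<Sum>i<N. d ?r)" by simp
    also have "\<dots> \<le> (\<Sum>i<N. potential T k (?f i) M ?r)" using M by (intro sum_mono) simp
    also have "\<dots> = potential T k (\<lambda>x. \<Sum>i<N. ?f i x) M ?r" by (rule potential_sum[symmetric])
    also have "\<dots> \<le> potential T k (\<lambda>x. 1 / (l * \<alpha>) * (l * a x * c x)) M ?r"
      by (intro potential_mono k le)
    also have "\<dots> = 1 / (l * \<alpha>) * potential T k (\<lambda>x. l * a x * c x) M ?r"
      by (rule potential_cmult)
    also have "\<dots> \<le> 1 / (l * \<alpha>) * ((1 + l * a ?r) * c ?r)"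
      using l \<alpha>(1) by (intro mult_left_mono energy) simp
    finally show ?thesis by (simp add: B_def)
  qed
  then have "d ?r \<le> 0"
    using reals_Archimedean3[of "d ?r"] by (meson not_le)
  with d[of ?r] show ?thesis by (simp add: d_def)
qed

section \<open>Left limits of the conductances and the conclusion\<close>

section \<open>Left continuity\<close>

text \<open>Left limits exist by monotonicity in the bias and inherit the recursion by continuity,
  so uniqueness applies. The bound at the fixed smaller bias \<open>l0\<close> passes to the left
  limit, again by monotonicity.\<close>

lemma below_conductance_tendsto_left:
  fixes A :: "nat \<Rightarrow> 'a set"
  assumes T: "rooted_tree T" "locally_finite T" and l0: "0 < l0" "l0 < l"
    and cut: "\<And>n. V_cutset T (A n)" and disj: "disjoint_family A"
    and \<alpha>: "0 < \<alpha>" "\<And>n v. v \<in> A n \<Longrightarrow> \<alpha> \<le> below_conductance l0 T v"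
  shows "((\<lambda>m. below_conductance m T (root T)) \<longlongrightarrow> below_conductance l T (root T)) (at_left l)"
proof -
  have l: "0 < l" using l0 by simp
  have ev: "eventually (\<lambda>m. l0 < m \<and> m < l) (at_left l)"
    using eventually_at_left_real[OF l0(2)] by simp
  \<comment> \<open>The left limit of an increasing function as a supremum; staying above
    \<open>l0\<close> keeps the bias positive, as \<open>branch_mono\<close> requires.\<close>
  define b where "b y = Sup ((\<lambda>m. branch m T y) ` {l0<..<l})" for y
  have lim: "((\<lambda>m. branch m T y) \<longlongrightarrow> b y) (at_left l)" for y
  proof -
    have "at_left l = at l within ({..<l} \<inter> {l0<..})"
      by (rule at_within_nhd[of _ "{l0<..}"]) (use l0 in auto)
    moreover have "{..<l} \<inter> {l0<..} = {l0<..<l}" by auto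
    moreover have "((\<lambda>m. branch m T y) \<longlongrightarrow> Sup ((\<lambda>m. branch m T y) ` ({..<l} \<inter> {l0<..})))
        (at l within ({..<l} \<inter> {l0<..}))"
      by (rule Lim_left_bound[of "{l0<..}" l "\<lambda>m. branch m T y" "branch l T y"])
         (use l0 in \<open>auto intro!: branch_mono\<close>)
    ultimately show ?thesis by (simp add: b_def)
  qed
  define a where "a x = (\<Sum>y\<in>children T x. b y)" for x
  have a_lim: "((\<lambda>m. below_conductance m T x) \<longlongrightarrow> a x) (at_left l)" for x
    unfolding below_conductance_def a_def by (intro tendsto_sum lim)
  have a_ge: "below_conductance l0 T x \<le> a x" for x
    using l0 by (intro tendsto_lowerbound[OF a_lim] eventually_mono[OF ev])
      (auto intro: below_conductance_mono)
  have a_le: "a x \<le> below_conductance l T x" for x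
    using l0 by (intro tendsto_upperbound[OF a_lim] eventually_mono[OF ev])
      (auto intro: below_conductance_mono)
  have a0: "0 \<le> a x" for x using a_ge[of x] below_conductance_nonneg[OF l0(1), of T x] by simp
  have b_eq: "b y = l * a y / (1 + l * a y)" for y
  proof (rule tendsto_unique[OF _ lim])
    have pos: "0 < 1 + l * a y" using l a0 by (simp add: add_pos_nonneg)
    have "((\<lambda>m. m * below_conductance m T y / (1 + m * below_conductance m T y))
        \<longlongrightarrow> l * a y / (1 + l * a y)) (at_left l)"
      using pos by (intro tendsto_intros a_lim) simp
    then show "((\<lambda>m. branch m T y) \<longlongrightarrow> l * a y / (1 + l * a y)) (at_left l)"
      by (rule Lim_transform_eventually)
         (use l0 in \<open>auto intro!: eventually_mono[OF ev] branch_eq[symmetric]\<close>)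
  qed simp
  have "a (root T) = below_conductance l T (root T)"
  proof (rule recursion_unique[OF T l cut disj a0 a_le _ _ \<alpha>(1)])
    show "a x = (\<Sum>y\<in>children T x. l * a y / (1 + l * a y))" for x
      unfolding a_def[of x] by (simp add: b_eq)
    show "below_conductance l T x =
        (\<Sum>y\<in>children T x. l * below_conductance l T y / (1 + l * below_conductance l T y))" for x
      unfolding below_conductance_def[of l T x] by (simp add: branch_eq[OF l])
    show "\<alpha> \<le> a v" if "v \<in> A n" for n v using \<alpha>(2)[OF that] a_ge[of v] by simp
  qed
  with a_lim[of "root T"] show ?thesis by simp
qed

theorem theorem37:
  fixes T :: "'a rtree" and lc :: real
  assumes "rooted_tree T" and "infinite (verts T)" and "locally_finite T"
    and "critical_value T lc"
    and "weakly_uniformly_transient T lc"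
  shows "\<forall>l \<in> {lc<..1}. continuous (at_left l) (\<lambda>l. effective_conductance l T)"
proof
  fix l assume "l \<in> {lc<..1}"
  then have lc: "0 \<le> lc" "lc < l" using assms(4) by (auto simp: critical_value_def)
  note T = assms(1,3)
  from assms(5) obtain \<pi> :: "nat \<Rightarrow> 'a set"
    where cut: "\<forall>n\<ge>1. finite (\<pi> n) \<and> V_cutset T (\<pi> n)"
    and disj: "disjoint_family_on \<pi> {1..}"
    and unif: "\<forall>m>lc. \<exists>\<alpha>>0. \<forall>v \<in> (\<Union>k\<in>{1..}. \<pi> k). escape_prob m (subtree T v) v \<ge> \<alpha>"
    unfolding weakly_uniformly_transient_def by (elim exE conjE)
  \<comment> \<open>The constant of uniform transience depends on the bias. Fixing one
    \<open>l0\<close> strictly between \<open>lc\<close> and \<open>l\<close> yields an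
    \<open>\<alpha>\<close> that serves all biases in between.\<close>
  obtain l0 where l0: "lc < l0" "l0 < l" using dense[OF lc(2)] by blast
  then have l0_pos: "0 < l0" using lc by simp
  obtain \<alpha> where \<alpha>: "0 < \<alpha>"
    and esc: "\<And>k v. 1 \<le> k \<Longrightarrow> v \<in> \<pi> k \<Longrightarrow> \<alpha> \<le> escape_prob l0 (subtree T v) v"
    using unif[rule_format, OF l0(1)] by auto
  have "\<alpha> \<le> below_conductance l0 T v" if "v \<in> \<pi> (Suc n)" for n v
    using esc[OF _ that] \<alpha> escape_le_below_conductance[OF T l0_pos, of v] by simp
  moreover have "disjoint_family (\<lambda>n. \<pi> (Suc n))"
    using disj by (auto simp: disjoint_family_on_def)
  ultimately have "((\<lambda>m. below_conductance m T (root T)) \<longlongrightarrow> below_conductance l T (root T))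
      (at_left l)"
    using cut \<alpha> by (intro below_conductance_tendsto_left[OF T l0_pos l0(2), of "\<lambda>n. \<pi> (Suc n)" \<alpha>]) auto
  moreover have "eventually (\<lambda>m. below_conductance m T (root T) = effective_conductance m T) (at_left l)"
    using eventually_at_left_real[OF l0(2)]
    by eventually_elim (use l0_pos in \<open>simp add: effective_conductance_eq[OF T]\<close>)
  ultimately have "((\<lambda>m. effective_conductance m T) \<longlongrightarrow> below_conductance l T (root T)) (at_left l)"
    by (rule Lim_transform_eventually)
  moreover have "below_conductance l T (root T) = effective_conductance l T"
    using lc by (simp add: effective_conductance_eq[OF T])
  ultimately show "continuous (at_left l) (\<lambda>l. effective_conductance l T)"
    by (simp add: continuous_within)
qed

end
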